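(* Let $\beta$ be a unit-speed timelike curve in $\mathbb{E}^4_1$ with Frenet frame $\{F_1,F_2,F_3,F_4\}$ and first curvature $k_1$, let $r>0$ be constant, and let $M$ be the tubular hypersurface $$\mathcal{T}(s,t,w)=\beta(s)+r(\cos t\cos w\,F_2(s)+\sin t\cos w\,F_3(s)+\sin w\,F_4(s))$$ in $\mathbb{E}^4_1$, with Gauss map $N=-(\cos t\cos w\,F_2+\sin t\cos w\,F_3+\sin w\,F_4)$. Then $M$ has first kind $\mathcal{L}_1$-(global) pointwise 1-type Gauss map, i.e. $\mathcal{L}_1N=\mathfrak{m}N$ with $\mathfrak{m}$ a non-zero constant, if and only if $k_1=0$ (identically); here $\mathfrak{m}=\frac{2}{r^3}$.
   Context: $\mathbb{E}^4_1$ is $\mathbb{R}^4$ with the metric $\langle\ ,\ \rangle=-dx_1^2+dx_2^2+dx_3^2+dx_4^2$. The curve $\beta:I\to\mathbb{E}^4_1$ ($I$ an open interval) is smooth with $\beta'=F_1$, and $\{F_1,F_2,F_3,F_4\}$ is a smooth orthonormal frame along $\beta$ with $\langle F_1,F_1\rangle=-1$, $\langle F_i,F_i\rangle=1$ ($i=2,3,4$), satisfying the Frenet equations $F_1'=k_1F_2$, $F_2'=k_1F_1+k_2F_3$, $F_3'=-k_2F_2+k_3F_4$, $F_4'=-k_3F_3$, where $k_1,k_2,k_3$ are smooth functions of $s$ (the curvatures of $\beta$; they are allowed to vanish). The parameters $(s,t,w)$ range over a connected open set $U\subset I\times\mathbb{R}^2$ projecting onto $I$ on which $\mathcal{T}$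 is an immersion, i.e. $\cos w\neq0$ and $1+rk_1\cos t\cos w\neq0$. The unit normal $N$ has $\varepsilon=\langle N,N\rangle=1$, and the principal curvatures with respect to $N$ (eigenvalues of the shape operator $-dN$) are $\kappa_1=\kappa_2=\frac1r$, $\kappa_3=\frac{k_1\cos t\cos w}{1+rk_1\cos t\cos w}$. Operator $\mathcal{L}_1$ (Cheng–Yau) on the Gauss map: put $a_1=-\sum_i\kappa_i$, $a_k=(-1)^k\sum_{i_1<\dots<i_k}\kappa_{i_1}\cdots\kappa_{i_k}$ ($k=2,3$), and define $H_k$ by $\binom{3}{k}H_k=(-\varepsilon)^ka_k$. Then $$\mathcal{L}_1N=-\varepsilon\,\mathfrak{C}_1\big(\nabla H_2+(3H_1H_2-H_3)N\big),\qquad \mathfrak{C}_1=\binom32(-\varepsilon)=-3\varepsilon,$$ where $\nabla$ is the gradient on $M$ with respect to the induced metric, viewed as an $\mathbb{E}^4_1$-valued map. $M$ has first kind $\mathcal{L}_1$-pointwise 1-type Gauss map if $\mathcal{L}_1N=\mathfrak{m}N$ for a non-zero smooth function $\mathfrak{m}$ on $M$; the word "(global)" is added when $\mathfrak{m}$ is constant. *)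

theory Defs
  imports "HOL-Analysis.Analysis"
begin

text \<open>On an open set this is the class of \<open>C\<^sup>\<infinity>\<close> maps: every iterated directional derivative
  exists and is (Frechet) differentiable.\<close>

coinductive smooth_on :: "'a::real_normed_vector set \<Rightarrow> ('a \<Rightarrow> 'b::real_normed_vector) \<Rightarrow> bool"
  for U where
  "\<lbrakk>\<forall>x\<in>U. f differentiable (at x); \<forall>v. smooth_on U (\<lambda>x. frechet_derivative f (at x) v)\<rbrakk>
    \<Longrightarrow> smooth_on U f"

definition lorentz :: "real^4 \<Rightarrow> real^4 \<Rightarrow> real" where
  "lorentz x y = - (x$1 * y$1) + x$2 * y$2 + x$3 * y$3 + x$4 * y$4"

text \<open>The frame is indexed by the four-element type \<open>4\<close>, in which the numeral \<open>4\<close> equals \<open>0\<close>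
  and \<open>1, 2, 3, 4\<close> are distinct.\<close>

definition timelike_frenet_curve ::
  "real set \<Rightarrow> (real \<Rightarrow> real^4) \<Rightarrow> (4 \<Rightarrow> real \<Rightarrow> real^4) \<Rightarrow>
   (real \<Rightarrow> real) \<Rightarrow> (real \<Rightarrow> real) \<Rightarrow> (real \<Rightarrow> real) \<Rightarrow> bool" where
  "timelike_frenet_curve I \<beta> F k1 k2 k3 \<longleftrightarrow>
     smooth_on I \<beta> \<and> (\<forall>i. smooth_on I (F i)) \<and>
     smooth_on I k1 \<and> smooth_on I k2 \<and> smooth_on I k3 \<and>
     (\<forall>s\<in>I.
        (\<forall>i j. lorentz (F i s) (F j s) = (if i = j then (if i = 1 then -1 else 1) else 0)) \<and>
        (\<beta> has_vector_derivative F 1 s) (at s) \<and>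
        (F 1 has_vector_derivative k1 s *\<^sub>R F 2 s) (at s) \<and>
        (F 2 has_vector_derivative k1 s *\<^sub>R F 1 s + k2 s *\<^sub>R F 3 s) (at s) \<and>
        (F 3 has_vector_derivative - k2 s *\<^sub>R F 2 s + k3 s *\<^sub>R F 4 s) (at s) \<and>
        (F 4 has_vector_derivative - k3 s *\<^sub>R F 3 s) (at s))"

text \<open>Hypersurfaces are given by a parametrization \<open>X\<close> of an open subset of \<open>\<real>\<^sup>3\<close> together with
  a normal field \<open>N\<close>; functions and vector fields on the hypersurface are functions of the
  parameter. Here \<open>(s, t, w) = (p$1, p$2, p$3)\<close>.\<close>

definition tube_normal :: "(4 \<Rightarrow> real \<Rightarrow> real^4) \<Rightarrow> real^3 \<Rightarrow> real^4" where
  "tube_normal F p =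
     - ((cos (p$2) * cos (p$3)) *\<^sub>R F 2 (p$1) + (sin (p$2) * cos (p$3)) *\<^sub>R F 3 (p$1)
        + sin (p$3) *\<^sub>R F 4 (p$1))"

definition tube ::
  "(real \<Rightarrow> real^4) \<Rightarrow> (4 \<Rightarrow> real \<Rightarrow> real^4) \<Rightarrow> real \<Rightarrow> real^3 \<Rightarrow> real^4" where
  "tube \<beta> F r p =
     \<beta> (p$1) + r *\<^sub>R ((cos (p$2) * cos (p$3)) *\<^sub>R F 2 (p$1)
        + (sin (p$2) * cos (p$3)) *\<^sub>R F 3 (p$1) + sin (p$3) *\<^sub>R F 4 (p$1))"

definition immersion_on :: "(real^3) set \<Rightarrow> (real^3 \<Rightarrow> real^4) \<Rightarrow> bool" where
  "immersion_on U X \<longleftrightarrow> smooth_on U X \<and> (\<forall>p\<in>U. inj (frechet_derivative X (at p)))"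

text \<open>The shape operator \<open>-dN\<close>, transported from the tangent space to \<open>\<real>\<^sup>3\<close> along the linear
  isomorphism \<open>dX\<close>.\<close>

definition shape_operator ::
  "(real^3 \<Rightarrow> real^4) \<Rightarrow> (real^3 \<Rightarrow> real^4) \<Rightarrow> real^3 \<Rightarrow> real^3 \<Rightarrow> real^3" where
  "shape_operator X N p =
     (THE S. linear S \<and>
        (\<forall>v. frechet_derivative X (at p) (S v) = - frechet_derivative N (at p) v))"

text \<open>The eigenvalues of the shape operator, repeated according to algebraic multiplicity. Their
  order is arbitrary; only symmetric functions of them are used.\<close>

definition principal_curvatures ::
  "(real^3 \<Rightarrow> real^4) \<Rightarrow> (real^3 \<Rightarrow> real^4) \<Rightarrow> real^3 \<Rightarrow> real^3" where
  "principal_curvatures X N p =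
     (SOME \<kappa>. \<forall>x. det (mat x - matrix (shape_operator X N p)) = (\<Prod>i\<in>UNIV. x - \<kappa> $ i))"

definition curvature_coeff ::
  "(real^3 \<Rightarrow> real^4) \<Rightarrow> (real^3 \<Rightarrow> real^4) \<Rightarrow> nat \<Rightarrow> real^3 \<Rightarrow> real" where
  "curvature_coeff X N k p =
     (-1) ^ k * (\<Sum>J | card J = k. \<Prod>i\<in>J. principal_curvatures X N p $ i)"

definition mean_curvature ::
  "(real^3 \<Rightarrow> real^4) \<Rightarrow> (real^3 \<Rightarrow> real^4) \<Rightarrow> nat \<Rightarrow> real^3 \<Rightarrow> real" where
  "mean_curvature X N k p =
     (- lorentz (N p) (N p)) ^ k * curvature_coeff X N k p / real (3 choose k)"

text \<open>The gradient with respect to the induced metric, as a tangent vector in the ambient space.\<close>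

definition hypersurface_gradient ::
  "(real^3 \<Rightarrow> real^4) \<Rightarrow> (real^3 \<Rightarrow> real) \<Rightarrow> real^3 \<Rightarrow> real^4" where
  "hypersurface_gradient X f p =
     (THE V. V \<in> range (frechet_derivative X (at p)) \<and>
        (\<forall>h. lorentz V (frechet_derivative X (at p) h) = frechet_derivative f (at p) h))"

text \<open>The value of the Cheng--Yau operator \<open>\<L>\<^sub>1\<close> on the Gauss map \<open>N\<close>. Its expression
  through the mean curvatures \<open>H\<^sub>k\<close> is taken as the definition.\<close>

definition L1_gauss ::
  "(real^3 \<Rightarrow> real^4) \<Rightarrow> (real^3 \<Rightarrow> real^4) \<Rightarrow> real^3 \<Rightarrow> real^4" where
  "L1_gauss X N p =
     (let \<epsilon> = lorentz (N p) (N p);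
          C1 = real (3 choose 2) * (- \<epsilon>);
          H = (\<lambda>k. mean_curvature X N k p)
      in (- \<epsilon> * C1) *\<^sub>R
           (hypersurface_gradient X (mean_curvature X N 2) p + (3 * H 1 * H 2 - H 3) *\<^sub>R N p))"

definition first_kind_L1_pointwise_1_type ::
  "(real^3) set \<Rightarrow> (real^3 \<Rightarrow> real^4) \<Rightarrow> (real^3 \<Rightarrow> real^4) \<Rightarrow> (real^3 \<Rightarrow> real) \<Rightarrow> bool" where
  "first_kind_L1_pointwise_1_type U X N m \<longleftrightarrow>
     smooth_on U m \<and> (\<forall>p\<in>U. m p \<noteq> 0) \<and> (\<forall>p\<in>U. L1_gauss X N p = m p *\<^sub>R N p)"

definition first_kind_L1_global_pointwise_1_type ::
  "(real^3) set \<Rightarrow> (real^3 \<Rightarrow> real^4) \<Rightarrow> (real^3 \<Rightarrow> real^4) \<Rightarrow> real \<Rightarrow> bool" where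
  "first_kind_L1_global_pointwise_1_type U X N c \<longleftrightarrow>
     first_kind_L1_pointwise_1_type U X N (\<lambda>_. c)"

end

theory Submission imports Defs
begin

text \<open>In the moving frame \<open>F\<^sub>1, \<partial>\<^sub>t n, \<partial>\<^sub>w n\<close> with \<open>n = - N\<close>, the shape operator is \<open>1/r\<close> times the
  identity minus a rank-one map, so two principal curvatures are \<open>1/r\<close> and the third is
  \<open>x = y / (1 + r y)\<close> with \<open>y = k\<^sub>1 cos t cos w\<close>. If \<open>\<L>\<^sub>1 N\<close> is proportional to \<open>N\<close>, its tangential
  part \<open>3 \<nabla>H\<^sub>2\<close> vanishes; hence \<open>H\<^sub>2\<close>, an injective affine function of \<open>x\<close>, is locally constant, and so
  is \<open>y\<close>. Moving \<open>t\<close> alone changes \<open>cos t\<close>, which forces \<open>k\<^sub>1 = 0\<close>.\<close>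

section \<open>Bilinearity of the metric and smoothness of constants\<close>

lemma lorentz_linear [simp]:
  "lorentz (x + y) z = lorentz x z + lorentz y z"
  "lorentz (x - y) z = lorentz x z - lorentz y z"
  "lorentz (- x) z = - lorentz x z"
  "lorentz (c *\<^sub>R x) z = c * lorentz x z"
  "lorentz 0 z = 0"
  "lorentz z (x + y) = lorentz z x + lorentz z y"
  "lorentz z (x - y) = lorentz z x - lorentz z y"
  "lorentz z (- x) = - lorentz z x"
  "lorentz z (c *\<^sub>R x) = c * lorentz z x"
  "lorentz z 0 = 0"
  by (simp_all add: lorentz_def algebra_simps)

text \<open>The coinduction runs over the class of all constant maps: a derivative of
  \<open>c\<close> is the constant 0, so the class must not be tied to one value.\<close>

lemma smooth_on_const: "smooth_on U (\<lambda>_. c)"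
proof -
  have "smooth_on U f" if "\<exists>c. f = (\<lambda>_. c)" for f :: "'a \<Rightarrow> 'b"
    using that
  proof (coinduction arbitrary: f)
    case smooth_on
    then show ?case by (auto simp: frechet_derivative_const)
  qed
  then show ?thesis by blast
qed

lemma smooth_on_imp_differentiable:
  "smooth_on U f \<Longrightarrow> x \<in> U \<Longrightarrow> f differentiable (at x)"
  by (auto elim: smooth_on.cases)

section \<open>Symmetric functions of three roots and the mean curvatures\<close>

lemma subsets_3_by_card:
  "{J::3 set. card J = 1} = {{1}, {2}, {3}}"
  "{J::3 set. card J = 2} = {{1, 2}, {1, 3}, {2, 3}}"
  "{J::3 set. card J = 3} = {{1, 2, 3}}"
proof -
  have "Pow (UNIV :: 3 set) = {{}, {1}, {2}, {3}, {1, 2}, {1, 3}, {2, 3}, {1, 2, 3}}"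
    by (simp only: UNIV_3 Pow_insert Pow_empty image_insert image_empty Un_insert_left Un_empty_left)
      (simp add: insert_commute)
  then have *: "{J. P J} = {J \<in> {{}, {1}, {2}, {3}, {1, 2}, {1, 3}, {2, 3}, {1, 2, 3}}. P J}"
    for P :: "3 set \<Rightarrow> bool"
    by (metis (mono_tags, lifting) Collect_cong Pow_UNIV UNIV_I)
  show "{J::3 set. card J = 1} = {{1}, {2}, {3}}"
    by (subst *) auto
  show "{J::3 set. card J = 2} = {{1, 2}, {1, 3}, {2, 3}}"
    by (subst *) auto
  show "{J::3 set. card J = 3} = {{1, 2, 3}}"
    by (subst *) auto
qed

lemma elementary_symmetric_3:
  fixes x :: "real^3"
  shows "(\<Sum>J | card J = 1. \<Prod>i\<in>J. x $ i) = x$1 + x$2 + x$3"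
    and "(\<Sum>J | card J = 2. \<Prod>i\<in>J. x $ i) = x$1 * x$2 + x$1 * x$3 + x$2 * x$3"
    and "(\<Sum>J | card J = 3. \<Prod>i\<in>J. x $ i) = x$1 * x$2 * x$3"
proof -
  \<comment> \<open>Without distinctness of the three pairs, the sum over the explicit set of pairs
    would not split into three terms.\<close>
  have "{1, 2} \<noteq> {1, 3::3}" "{1, 2} \<noteq> {2, 3::3}" "{1, 3} \<noteq> {2, 3::3}"
    by (auto simp: doubleton_eq_iff)
  then show "(\<Sum>J | card J = 1. \<Prod>i\<in>J. x $ i) = x$1 + x$2 + x$3"
    "(\<Sum>J | card J = 2. \<Prod>i\<in>J. x $ i) = x$1 * x$2 + x$1 * x$3 + x$2 * x$3"
    "(\<Sum>J | card J = 3. \<Prod>i\<in>J. x $ i) = x$1 * x$2 * x$3"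
    unfolding subsets_3_by_card by simp_all
qed

text \<open>The difference of two monic cubics has degree at most 2, so the values at 0, 1 and -1
  already force equal coefficients.\<close>

lemma monic_cubic_roots_symmetric:
  fixes a b c x y z :: real
  assumes "\<And>u. (u - a) * (u - b) * (u - c) = (u - x) * (u - y) * (u - z)"
  shows "x + y + z = a + b + c"
    and "x * y + x * z + y * z = a * b + a * c + b * c"
    and "x * y * z = a * b * c"
  using assms[of 0] assms[of 1] assms[of "-1"] by algebra+

text \<open>\<open>principal_curvatures\<close> is an arbitrary choice of roots, so its entries
  cannot be computed one by one. A real factorization shows that a choice exists, and the symmetric
  functions do not depend on it.\<close>

lemma mean_curvature_charpoly:
  assumes "\<And>x. det (mat x - matrix (shape_operator X N p)) = (x - a) * (x - b) * (x - c)"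
    and "lorentz (N p) (N p) = 1"
  shows "mean_curvature X N 1 p = (a + b + c) / 3"
    and "mean_curvature X N 2 p = (a * b + a * c + b * c) / 3"
    and "mean_curvature X N 3 p = a * b * c"
proof -
  let ?\<kappa> = "principal_curvatures X N p"
  have "\<forall>x. det (mat x - matrix (shape_operator X N p)) = (\<Prod>i\<in>UNIV. x - vector [a, b, c] $ (i::3))"
    unfolding assms(1) UNIV_3 by (simp add: mult.assoc)
  then have "\<forall>x. det (mat x - matrix (shape_operator X N p)) = (\<Prod>i\<in>UNIV. x - ?\<kappa> $ i)"
    unfolding principal_curvatures_def by (rule someI)
  then have *: "(x - a) * (x - b) * (x - c) = (x - ?\<kappa>$1) * (x - ?\<kappa>$2) * (x - ?\<kappa>$3)" for x
    unfolding assms(1) UNIV_3 by (drule_tac spec[of _ x]) (simp add: mult.assoc)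
  \<comment> \<open>For a unit normal with \<open>lorentz (N p) (N p) = 1\<close> the two signs
    \<open>(-1) ^ k\<close> cancel.\<close>
  have H: "mean_curvature X N k p = (\<Sum>J | card J = k. \<Prod>i\<in>J. ?\<kappa> $ i) / real (3 choose k)" for k
    by (simp add: mean_curvature_def curvature_coeff_def assms(2) mult.assoc[symmetric]
        flip: power_mult_distrib)
  have "(3::nat) choose 2 = 3" by (simp add: eval_nat_numeral)
  then show "mean_curvature X N 1 p = (a + b + c) / 3"
    "mean_curvature X N 2 p = (a * b + a * c + b * c) / 3"
    "mean_curvature X N 3 p = a * b * c"
    unfolding H elementary_symmetric_3 monic_cubic_roots_symmetric[OF *] by simp_all
qed

section \<open>The gradient for a nondegenerate induced metric\<close>

lemma linear_axis_expansion:
  fixes f :: "real^'n \<Rightarrow> 'b::real_vector"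
  assumes "linear f"
  shows "f h = (\<Sum>i\<in>UNIV. h $ i *\<^sub>R f (axis i 1))"
proof -
  have "f h = f (\<Sum>i\<in>UNIV. h $ i *\<^sub>R axis i 1)"
    using basis_expansion[of h] by (simp add: scalar_mult_eq_scaleR)
  then show ?thesis
    using assms by (simp add: linear_sum linear_scale)
qed

text \<open>A nondegenerate Gram form makes the index-lowering map \<open>\<real>\<^sup>3 \<rightarrow> (\<real>\<^sup>3)\<^sup>*\<close> bijective, so
  the definite description defining the gradient denotes.\<close>

lemma hypersurface_gradient:
  fixes X :: "real^3 \<Rightarrow> real^4"
  defines "L p \<equiv> frechet_derivative X (at p)"
  assumes L: "linear (L p)"
    and nondeg: "\<And>u. (\<And>h. lorentz (L p u) (L p h) = 0) \<Longrightarrow> u = 0"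
    and f: "f differentiable (at p)"
  shows "hypersurface_gradient X f p \<in> range (L p)"
    and "lorentz (hypersurface_gradient X f p) (L p h) = frechet_derivative f (at p) h"
proof -
  let ?f = "frechet_derivative f (at p)"
  define G where "G u = (\<chi> i. lorentz (L p u) (L p (axis i 1)))" for u :: "real^3"
  have lf: "linear ?f"
    using f by (rule linear_frechet_derivative)
  have expand: "lorentz (L p u) (L p h) = (\<Sum>i\<in>UNIV. h $ i * G u $ i)" for u h
    unfolding linear_axis_expansion[OF L, of h] by (simp add: sum_3 G_def)
  have lG: "linear G"
    by (rule linearI) (simp_all add: G_def vec_eq_iff linear_add[OF L] linear_scale[OF L])
  have "inj G"
    unfolding linear_injective_0[OF lG] using nondeg expand by simp
  then have "surj G"
    by (rule linear_inj_imp_surj[OF lG])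
  then obtain u where u: "(\<chi> i. ?f (axis i 1)) = G u"
    by (rule surjE)
  have fexp: "?f h = (\<Sum>i\<in>UNIV. h $ i * ?f (axis i 1))" for h
    using linear_axis_expansion[OF lf, of h] by simp
  let ?P = "\<lambda>V. V \<in> range (L p) \<and> (\<forall>h. lorentz V (L p h) = ?f h)"
  have "lorentz (L p u) (L p h) = ?f h" for h
    unfolding expand fexp[of h] u[symmetric] by simp
  then have "?P (L p u)" by simp
  moreover have "V = L p u" if V: "?P V" for V
  proof -
    obtain v where v: "V = L p v" using V by blast
    have "lorentz (L p (v - u)) (L p h) = 0" for h
      using V \<open>?P (L p u)\<close> v by (simp add: linear_diff[OF L])
    then have "v - u = 0" by (rule nondeg)
    then show ?thesis using v by simp
  qed
  ultimately have "?P (THE V. ?P V)"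
    by (rule theI)
  then show "hypersurface_gradient X f p \<in> range (L p)"
    "lorentz (hypersurface_gradient X f p) (L p h) = frechet_derivative f (at p) h"
    unfolding hypersurface_gradient_def L_def by auto
qed

section \<open>The tube and its moving frame\<close>

locale timelike_tube =
  fixes I :: "real set" and U :: "(real^3) set" and r :: real
    and \<beta> :: "real \<Rightarrow> real^4" and F :: "4 \<Rightarrow> real \<Rightarrow> real^4"
    and k1 k2 k3 :: "real \<Rightarrow> real"
  assumes frenet: "timelike_frenet_curve I \<beta> F k1 k2 k3"
    and r_pos: "r > 0"
    and open_U: "open U"
    and proj_U: "(\<lambda>p. p $ 1) ` U = I"
    and immersion: "immersion_on U (tube \<beta> F r)"
begin

abbreviation "X \<equiv> tube \<beta> F r"
abbreviation "N \<equiv> tube_normal F"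

text \<open>The t-derivative of \<open>- N\<close>. It is left unnormalized and vanishes where cos w
  = 0.\<close>

definition sphere_t :: "real^3 \<Rightarrow> real^4" where
  "sphere_t p = (- sin (p$2) * cos (p$3)) *\<^sub>R F 2 (p$1) + (cos (p$2) * cos (p$3)) *\<^sub>R F 3 (p$1)"

definition sphere_w :: "real^3 \<Rightarrow> real^4" where
  "sphere_w p = (- cos (p$2) * sin (p$3)) *\<^sub>R F 2 (p$1) + (- sin (p$2) * sin (p$3)) *\<^sub>R F 3 (p$1)
     + cos (p$3) *\<^sub>R F 4 (p$1)"

definition bend :: "real^3 \<Rightarrow> real" where
  "bend p = k1 (p$1) * cos (p$2) * cos (p$3)"

text \<open>\<open>rot_t\<close> and \<open>rot_w\<close> are the coefficients of \<open>sphere_t\<close> and \<open>sphere_w\<close> in the \<open>s\<close>-derivative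
  of \<open>- N\<close>; the remaining component of that derivative is \<open>bend\<close> times \<open>F\<^sub>1\<close>.\<close>

definition rot_t :: "real^3 \<Rightarrow> real" where
  "rot_t p = k2 (p$1) - k3 (p$1) * cos (p$2) * sin (p$3) / cos (p$3)"

definition rot_w :: "real^3 \<Rightarrow> real" where
  "rot_w p = k3 (p$1) * sin (p$2)"

lemma nonempty_U: "I \<noteq> {} \<Longrightarrow> U \<noteq> {}"
  using proj_U by auto

lemma fst_in_I: "p \<in> U \<Longrightarrow> p$1 \<in> I"
  using proj_U by auto

lemma frame_lorentz:
  "p \<in> U \<Longrightarrow> lorentz (F i (p$1)) (F j (p$1)) = (if i = j then (if i = 1 then -1 else 1) else 0)"
  using frenet fst_in_I unfolding timelike_frenet_curve_def by blast

section \<open>First derivatives of the normal and of the tube\<close>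

lemma has_derivative_along_curve:
  assumes "(f has_vector_derivative f') (at (p$1))"
  shows "((\<lambda>q::real^3. f (q$1)) has_derivative (\<lambda>h. h$1 *\<^sub>R f')) (at p)"
proof -
  have "((\<lambda>q::real^3. q$1) has_derivative (\<lambda>h. h$1)) (at p)"
    by (rule bounded_linear.has_derivative[OF bounded_linear_vec_nth]) simp
  from has_derivative_compose[OF this assms[unfolded has_vector_derivative_def]]
  show ?thesis .
qed

lemma frenet_derivatives:
  assumes "p \<in> U"
  shows "((\<lambda>q. \<beta> (q$1)) has_derivative (\<lambda>h. h$1 *\<^sub>R F 1 (p$1))) (at p)"
    and "((\<lambda>q. F 2 (q$1)) has_derivative (\<lambda>h. h$1 *\<^sub>R (k1 (p$1) *\<^sub>R F 1 (p$1) + k2 (p$1) *\<^sub>R F 3 (p$1)))) (at p)"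
    and "((\<lambda>q. F 3 (q$1)) has_derivative (\<lambda>h. h$1 *\<^sub>R (- k2 (p$1) *\<^sub>R F 2 (p$1) + k3 (p$1) *\<^sub>R F 4 (p$1)))) (at p)"
    and "((\<lambda>q. F 4 (q$1)) has_derivative (\<lambda>h. h$1 *\<^sub>R (- k3 (p$1) *\<^sub>R F 3 (p$1)))) (at p)"
  using frenet fst_in_I[OF assms] unfolding timelike_frenet_curve_def
  by (blast intro: has_derivative_along_curve)+

text \<open>The s-part stays in the Frenet frame here: expressing it through \<open>sphere_t\<close>
  divides by cos w, whose nonvanishing is itself deduced from this formula.\<close>

lemma normal_has_derivative_raw:
  assumes "p \<in> U"
  shows "(N has_derivative (\<lambda>h. - (h$1 *\<^sub>R (bend p *\<^sub>R F 1 (p$1)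
      + (- k2 (p$1) * sin (p$2) * cos (p$3)) *\<^sub>R F 2 (p$1)
      + (k2 (p$1) * cos (p$2) * cos (p$3) - k3 (p$1) * sin (p$3)) *\<^sub>R F 3 (p$1)
      + (k3 (p$1) * sin (p$2) * cos (p$3)) *\<^sub>R F 4 (p$1))
      + h$2 *\<^sub>R sphere_t p + h$3 *\<^sub>R sphere_w p))) (at p)"
proof -
  have c: "((\<lambda>q::real^3. q$i) has_derivative (\<lambda>h. h$i)) (at p)" for i
    by (rule bounded_linear.has_derivative[OF bounded_linear_vec_nth]) simp
  show ?thesis
    unfolding tube_normal_def[abs_def]
    by (rule has_derivative_eq_rhs, (rule derivative_intros frenet_derivatives[OF assms] c)+)
      (simp add: fun_eq_iff sphere_t_def sphere_w_def bend_def algebra_simps)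
qed

lemma tube_eq: "X = (\<lambda>p. \<beta> (p$1) - r *\<^sub>R N p)"
  by (simp add: fun_eq_iff tube_def tube_normal_def algebra_simps)

lemma tube_has_derivative_raw:
  assumes "p \<in> U"
  shows "(X has_derivative (\<lambda>h. h$1 *\<^sub>R F 1 (p$1) - r *\<^sub>R frechet_derivative N (at p) h)) (at p)"
proof -
  have "(N has_derivative frechet_derivative N (at p)) (at p)"
    using differentiableI[OF normal_has_derivative_raw[OF assms]]
    by (rule frechet_derivative_works[THEN iffD1])
  then show ?thesis
    unfolding tube_eq by (intro has_derivative_diff has_derivative_scaleR_right frenet_derivatives[OF assms])
qed

lemma inj_dX: "p \<in> U \<Longrightarrow> inj (frechet_derivative X (at p))"
  using immersion by (auto simp: immersion_on_def)

lemma linear_dX: "p \<in> U \<Longrightarrow> linear (frechet_derivative X (at p))"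
  using immersion by (auto simp: immersion_on_def
      intro: linear_frechet_derivative smooth_on_imp_differentiable)

lemma dX_eq_0D: "p \<in> U \<Longrightarrow> frechet_derivative X (at p) h = 0 \<Longrightarrow> h = 0"
  using inj_dX linear_dX linear_injective_0 by blast

text \<open>The t-derivative of the tube is \<open>r\<close> times \<open>sphere_t\<close>, so at
  cos w = 0 the map \<open>X\<close> would fail to be an immersion.\<close>

lemma cos_w_nonzero:
  assumes "p \<in> U"
  shows "cos (p$3) \<noteq> 0"
proof
  assume 0: "cos (p$3) = 0"
  have "frechet_derivative X (at p) (axis 2 1) = 0"
    unfolding frechet_derivative_at[OF tube_has_derivative_raw[OF assms], symmetric]
      frechet_derivative_at[OF normal_has_derivative_raw[OF assms], symmetric]
    by (simp add: axis_def sphere_t_def 0)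
  then have "axis 2 1 = (0::real^3)"
    by (rule dX_eq_0D[OF assms])
  then show False by simp
qed

lemma dN:
  assumes "p \<in> U"
  shows "frechet_derivative N (at p) h =
    - ((bend p * h$1) *\<^sub>R F 1 (p$1) + (h$2 + rot_t p * h$1) *\<^sub>R sphere_t p
       + (h$3 + rot_w p * h$1) *\<^sub>R sphere_w p)"
proof -
  have [simp]: "cos (p$3) \<noteq> 0" using cos_w_nonzero[OF assms] .
  have t: "rot_t p * cos (p$3) = k2 (p$1) * cos (p$3) - k3 (p$1) * cos (p$2) * sin (p$3)"
    by (simp add: rot_t_def left_diff_distrib)
  \<comment> \<open>Inserting cos^2 t + sin^2 t = 1 splits this term into a \<open>sphere_t\<close>
    part and a \<open>sphere_w\<close> part. The facts \<open>2\<close>, \<open>3\<close>,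
    \<open>4\<close> match the coefficients of \<open>F 2\<close>, \<open>F 3\<close>,
    \<open>F 4\<close>.\<close>
  have "k3 (p$1) * sin (p$3) =
      k3 (p$1) * sin (p$3) * (cos (p$2) * cos (p$2) + sin (p$2) * sin (p$2))"
    by (simp add: power2_eq_square[symmetric])
  also have "\<dots> = k3 (p$1) * cos (p$2) * sin (p$3) * cos (p$2) + rot_w p * sin (p$2) * sin (p$3)"
    unfolding rot_w_def by (simp only: ring_distribs mult_ac)
  finally have "k2 (p$1) * cos (p$2) * cos (p$3) - k3 (p$1) * sin (p$3) =
      rot_t p * cos (p$3) * cos (p$2) - rot_w p * sin (p$2) * sin (p$3)"
    unfolding t by (simp only: ring_distribs mult_ac)
  then have 3: "k2 (p$1) * cos (p$2) * cos (p$3) - k3 (p$1) * sin (p$3) =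
     rot_t p * (cos (p$2) * cos (p$3)) - rot_w p * (sin (p$2) * sin (p$3))"
    by (simp only: mult_ac)
  have "- k2 (p$1) * sin (p$2) * cos (p$3) =
     - (rot_t p * cos (p$3) * sin (p$2)) - rot_w p * (cos (p$2) * sin (p$3))"
    unfolding t rot_w_def by (simp add: algebra_simps)
  then have 2: "- k2 (p$1) * sin (p$2) * cos (p$3) =
     - (rot_t p * (sin (p$2) * cos (p$3))) - rot_w p * (cos (p$2) * sin (p$3))"
    by (simp only: mult_ac)
  have 4: "k3 (p$1) * sin (p$2) * cos (p$3) = rot_w p * cos (p$3)"
    unfolding rot_w_def by simp
  show ?thesis
    unfolding frechet_derivative_at[OF normal_has_derivative_raw[OF assms], symmetric] 2 3 4
    by (simp add: vec_eq_iff sphere_t_def sphere_w_def algebra_simps)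
qed

lemma dX:
  assumes "p \<in> U"
  shows "frechet_derivative X (at p) h =
    ((1 + r * bend p) * h$1) *\<^sub>R F 1 (p$1) + (r * (h$2 + rot_t p * h$1)) *\<^sub>R sphere_t p
       + (r * (h$3 + rot_w p * h$1)) *\<^sub>R sphere_w p"
  unfolding frechet_derivative_at[OF tube_has_derivative_raw[OF assms], symmetric] dN[OF assms]
  by (simp add: vec_eq_iff algebra_simps)

text \<open>The last two entries cancel the rotation terms in \<open>dX\<close>, so this parameter
  direction is mapped into the line of \<open>F 1\<close>.\<close>

definition lift :: "real^3 \<Rightarrow> real^3" where
  "lift p = vector [1, - rot_t p, - rot_w p]"

lemma dX_lift:
  "p \<in> U \<Longrightarrow> frechet_derivative X (at p) (lift p) = (1 + r * bend p) *\<^sub>R F 1 (p$1)"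
  by (simp add: dX lift_def)

text \<open>If the factor vanished, \<open>dX\<close> would kill \<open>lift p\<close>, whose first
  entry is 1.\<close>

lemma bend_nonzero:
  assumes "p \<in> U"
  shows "1 + r * bend p \<noteq> 0"
proof
  assume "1 + r * bend p = 0"
  then have "lift p = 0"
    using dX_lift[OF assms] dX_eq_0D[OF assms] by simp
  then have "lift p $ 1 = 0" by simp
  then show False by (simp add: lift_def)
qed

section \<open>Lorentz geometry of the tangent frame\<close>

lemma tangent_frame_lorentz:
  assumes "p \<in> U"
  shows "lorentz (F 1 (p$1)) (F 1 (p$1)) = -1"
    and "lorentz (F 1 (p$1)) (sphere_t p) = 0" "lorentz (sphere_t p) (F 1 (p$1)) = 0"
    and "lorentz (F 1 (p$1)) (sphere_w p) = 0" "lorentz (sphere_w p) (F 1 (p$1)) = 0"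
    and "lorentz (sphere_t p) (sphere_w p) = 0" "lorentz (sphere_w p) (sphere_t p) = 0"
    and "lorentz (sphere_t p) (sphere_t p) = (cos (p$3))\<^sup>2"
    and "lorentz (sphere_w p) (sphere_w p) = 1"
    and "lorentz (F 1 (p$1)) (N p) = 0"
    and "lorentz (sphere_t p) (N p) = 0"
    and "lorentz (sphere_w p) (N p) = 0"
    and "lorentz (N p) (N p) = 1"
proof -
  note frame = frame_lorentz[OF assms]
  have sq: "cos (p$2) * cos (p$2) + sin (p$2) * sin (p$2) = 1"
    "cos (p$3) * cos (p$3) + sin (p$3) * sin (p$3) = 1"
    by (simp_all add: power2_eq_square[symmetric])
  show "lorentz (F 1 (p$1)) (F 1 (p$1)) = -1"
    "lorentz (F 1 (p$1)) (sphere_t p) = 0" "lorentz (sphere_t p) (F 1 (p$1)) = 0"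
    "lorentz (F 1 (p$1)) (sphere_w p) = 0" "lorentz (sphere_w p) (F 1 (p$1)) = 0"
    "lorentz (F 1 (p$1)) (N p) = 0"
    by (simp_all add: frame sphere_t_def sphere_w_def tube_normal_def)
  show "lorentz (sphere_t p) (sphere_w p) = 0" "lorentz (sphere_w p) (sphere_t p) = 0"
    by (simp_all add: frame sphere_t_def sphere_w_def)
  show "lorentz (sphere_t p) (sphere_t p) = (cos (p$3))\<^sup>2"
    by (simp add: frame sphere_t_def power2_eq_square) (use sq in algebra)
  show "lorentz (sphere_w p) (sphere_w p) = 1"
    by (simp add: frame sphere_w_def) (use sq in algebra)
  show "lorentz (sphere_t p) (N p) = 0"
    by (simp add: frame sphere_t_def tube_normal_def)
  show "lorentz (sphere_w p) (N p) = 0"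
    by (simp add: frame sphere_w_def tube_normal_def) (use sq in algebra)
  show "lorentz (N p) (N p) = 1"
    by (simp add: frame tube_normal_def) (use sq in algebra)
qed

lemma tangent_orthogonal_normal:
  "p \<in> U \<Longrightarrow> lorentz (frechet_derivative X (at p) h) (N p) = 0"
  by (simp add: dX tangent_frame_lorentz)

text \<open>For an indefinite metric injectivity of \<open>dX\<close> is not enough; the tangent
  frame is orthogonal with no null vector. Pairing with \<open>lift p\<close> isolates
  \<open>u$1\<close>, and then the two axes isolate \<open>u$2\<close> and
  \<open>u$3\<close>.\<close>

lemma induced_metric_nondegenerate:
  assumes p: "p \<in> U"
    and *: "\<And>h. lorentz (frechet_derivative X (at p) u) (frechet_derivative X (at p) h) = 0"
  shows "u = 0"
proof -
  note simps = dX[OF p] tangent_frame_lorentz[OF p] cos_w_nonzero[OF p] bend_nonzero[OF p]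
  have r: "r \<noteq> 0" using r_pos by simp
  have "u$1 = 0"
    using *[of "lift p"] bend_nonzero[OF p] by (simp add: simps lift_def)
  moreover have "u$2 = 0"
    using *[of "axis 2 1"] r calculation by (simp add: simps axis_def)
  moreover have "u$3 = 0"
    using *[of "axis 3 1"] r calculation by (simp add: simps axis_def)
  ultimately show ?thesis
    by (simp add: vec_eq_iff forall_3)
qed

section \<open>Shape operator and mean curvatures of the tube\<close>

text \<open>Differentiating \<open>X\<close> = \<beta> - r \<open>N\<close> gives -dN v = (dX v -
  \<open>v$1\<close> \<open>F 1\<close>) / r, and \<open>F 1\<close> is dX of \<open>lift p\<close>
  divided by 1 + r \<open>bend p\<close>. Injectivity of dX makes this solution unique.\<close>

lemma shape_operator_tube:
  assumes p: "p \<in> U"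
  shows "shape_operator X N p = (\<lambda>v. (1/r) *\<^sub>R (v - (v$1 / (1 + r * bend p)) *\<^sub>R lift p))"
proof -
  let ?S = "\<lambda>v::real^3. (1/r) *\<^sub>R (v - (v$1 / (1 + r * bend p)) *\<^sub>R lift p)"
  have r: "r \<noteq> 0" using r_pos by simp
  have L: "frechet_derivative X (at p) v = v$1 *\<^sub>R F 1 (p$1) - r *\<^sub>R frechet_derivative N (at p) v" for v
    unfolding frechet_derivative_at[OF tube_has_derivative_raw[OF p], symmetric] by simp
  have "linear ?S"
    by (rule linearI) (simp_all add: vec_eq_iff field_simps add_divide_distrib)
  moreover have S: "frechet_derivative X (at p) (?S v) = - frechet_derivative N (at p) v" for v
    using linear_dX[OF p] r bend_nonzero[OF p]
    by (simp add: linear_scale linear_diff dX_lift[OF p] L[of v])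
  ultimately show ?thesis
    unfolding shape_operator_def
    by (intro the_equality conjI allI ext) (auto intro: injD[OF inj_dX[OF p]])
qed

text \<open>The second and third axes are eigenvectors for 1/r, so the matrix is lower triangular
  and its diagonal gives the roots.\<close>

lemma charpoly_shape_operator_tube:
  assumes p: "p \<in> U"
  shows "det (mat x - matrix (shape_operator X N p)) =
    (x - 1/r) * (x - 1/r) * (x - bend p / (1 + r * bend p))"
proof -
  have "(1 - 1 / (1 + r * bend p)) / r = bend p / (1 + r * bend p)"
    using r_pos bend_nonzero[OF p] by (simp add: diff_divide_eq_iff)
  then show ?thesis
    unfolding shape_operator_tube[OF p] det_3 matrix_def
    by (simp add: mat_def axis_def lift_def)
qed

lemma normal_unit: "p \<in> U \<Longrightarrow> lorentz (N p) (N p) = 1"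
  by (rule tangent_frame_lorentz)

lemmas mean_curvature_tube =
  mean_curvature_charpoly[OF charpoly_shape_operator_tube normal_unit]

lemma bend_differentiable:
  assumes p: "p \<in> U"
  shows "bend differentiable (at p)"
proof -
  have "k1 differentiable (at (p$1))"
    using frenet fst_in_I[OF p] unfolding timelike_frenet_curve_def
    by (blast intro: smooth_on_imp_differentiable)
  then obtain D where "(k1 has_vector_derivative D) (at (p$1))"
    using vector_derivative_works by blast
  then have k: "(\<lambda>q::real^3. k1 (q$1)) differentiable (at p)"
    using has_derivative_along_curve differentiableI by blast
  have c: "(\<lambda>q::real^3. q$i) differentiable (at p)" for i
    by (rule differentiableI[OF bounded_linear.has_derivative[OF bounded_linear_vec_nth]])
      (rule has_derivative_ident)
  have "(\<lambda>q::real^3. cos (q$i)) differentiable (at p)" for i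
    using differentiable_compose[of cos "\<lambda>q. q$i", OF _ c]
    by (simp add: field_differentiable_imp_differentiable field_differentiable_within_cos)
  then show ?thesis
    unfolding bend_def[abs_def] by (intro differentiable_mult k)
qed

text \<open>\<open>mean_curvature\<close> rests on a pointwise choice, so regularity comes from a
  closed formula that agrees with it on the open set \<open>U\<close>.\<close>

lemma mean_curvature_2_differentiable:
  assumes p: "p \<in> U"
  shows "mean_curvature X N 2 differentiable (at p)"
proof -
  let ?H = "\<lambda>q. (1/r * (1/r) + 1/r * (bend q / (1 + r * bend q)) + 1/r * (bend q / (1 + r * bend q))) / 3"
  have "?H differentiable (at p)"
    by (intro differentiable_add differentiable_mult differentiable_divide differentiable_const
        bend_differentiable[OF p] bend_nonzero[OF p]) auto
  then obtain D where "(?H has_derivative D) (at p)"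
    unfolding differentiable_def by blast
  then have "(mean_curvature X N 2 has_derivative D) (at p)"
    by (rule has_derivative_transform_within_open[OF _ open_U p]) (simp add: mean_curvature_tube)
  then show ?thesis
    by (rule differentiableI)
qed

lemmas gradient_H2 =
  hypersurface_gradient[OF linear_dX induced_metric_nondegenerate mean_curvature_2_differentiable]

section \<open>The operator on the Gauss map and the vanishing of \<open>k1\<close>\<close>

lemma L1_gauss_tube:
  assumes p: "p \<in> U"
  shows "L1_gauss X N p = 3 *\<^sub>R (hypersurface_gradient X (mean_curvature X N 2) p
    + (3 * mean_curvature X N 1 p * mean_curvature X N 2 p - mean_curvature X N 3 p) *\<^sub>R N p)"
proof -
  have "(3::nat) choose 2 = 3" by (simp add: eval_nat_numeral)
  then show ?thesis
    by (simp add: L1_gauss_def Let_def normal_unit[OF p])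
qed

lemma L1_eq_normal_imp_mean_curvature_2_critical:
  assumes p: "p \<in> U" and eq: "L1_gauss X N p = c *\<^sub>R N p"
  shows "frechet_derivative (mean_curvature X N 2) (at p) = (\<lambda>_. 0)"
proof -
  let ?q = "3 * mean_curvature X N 1 p * mean_curvature X N 2 p - mean_curvature X N 3 p"
  let ?V = "hypersurface_gradient X (mean_curvature X N 2) p"
  have e: "3 *\<^sub>R (?V + ?q *\<^sub>R N p) = c *\<^sub>R N p"
    using eq L1_gauss_tube[OF p] by simp
  have "lorentz ?V (N p) = 0"
    using gradient_H2(1)[OF p p _ p] tangent_orthogonal_normal[OF p] by auto
  \<comment> \<open>Pairing with \<open>N p\<close> removes the tangential gradient, so the normal
    terms of \<open>e\<close> agree and only the gradient is left.\<close>
  then have "c = 3 * ?q"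
    using arg_cong[OF e, of "\<lambda>v. lorentz v (N p)"] normal_unit[OF p] by simp
  then have "?V = 0"
    using e by (simp add: scaleR_add_right)
  then show "frechet_derivative (mean_curvature X N 2) (at p) = (\<lambda>_. 0)"
    using gradient_H2(2)[OF p p _ p] by (metis (no_types) ext lorentz_linear(5))
qed

lemma mean_curvature_2_eq_imp_bend_eq:
  assumes "p \<in> U" "q \<in> U" "mean_curvature X N 2 p = mean_curvature X N 2 q"
  shows "bend p = bend q"
proof -
  have cancel: "x = y" if "(a * a + a * x + a * x) / 3 = (a * a + a * y + a * y) / 3" "a \<noteq> 0"
    for a x y :: real
    using that by simp
  have "bend p / (1 + r * bend p) = bend q / (1 + r * bend q)"
    using r_pos by (intro cancel[OF assms(3)[unfolded mean_curvature_tube(2)[OF assms(1,1)]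
          mean_curvature_tube(2)[OF assms(2,2)]]]) simp
  \<comment> \<open>After cross-multiplication the terms r \<open>bend p\<close>
    \<open>bend q\<close> cancel.\<close>
  then show ?thesis
    using bend_nonzero[OF assms(1)] bend_nonzero[OF assms(2)] by (simp add: field_simps)
qed

lemma L1_eq_normal_imp_k1_zero:
  assumes eq: "\<And>p. p \<in> U \<Longrightarrow> L1_gauss X N p = c *\<^sub>R N p" and "s \<in> I"
  shows "k1 s = 0"
proof (rule ccontr)
  assume "k1 s \<noteq> 0"
  obtain p where p: "p \<in> U" "p$1 = s"
    using proj_U \<open>s \<in> I\<close> by auto
  obtain e where e: "e > 0" "ball p e \<subseteq> U"
    using open_U p openE by blast
  have "(mean_curvature X N 2 has_derivative (\<lambda>_. 0)) (at q within ball p e)" if "q \<in> ball p e" for q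
    using mean_curvature_2_differentiable[of q] L1_eq_normal_imp_mean_curvature_2_critical[OF _ eq, of q] that e
    by (metis frechet_derivative_works has_derivative_at_withinI subsetD)
  then obtain H where H: "\<And>q. q \<in> ball p e \<Longrightarrow> mean_curvature X N 2 q = H"
    using has_derivative_zero_constant[OF convex_ball] by metis
  have bend: "bend q = bend p" if "q \<in> ball p e" for q
    using mean_curvature_2_eq_imp_bend_eq[of q p] H[of q] H[of p] that e p by auto
  \<comment> \<open>e/2 keeps both displaced points in the ball; the bound 1 < pi makes sin d
    positive.\<close>
  define d where "d = min (e / 2) 1"
  have d: "0 < d" "d < e" "d \<le> 1" using e by (auto simp: d_def)
  have cos_eq: "cos (p$2 + x) = cos (p$2)" if "\<bar>x\<bar> = d" for x
  proof -
    have "p + x *\<^sub>R axis 2 1 \<in> ball p e"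
      using that d by (simp add: dist_norm)
    from bend[OF this] show ?thesis
      using \<open>k1 s \<noteq> 0\<close> p cos_w_nonzero[OF p(1)] by (simp add: bend_def axis_def)
  qed
  have "cos (p$2) * cos d - sin (p$2) * sin d = cos (p$2)"
    "cos (p$2) * cos d + sin (p$2) * sin d = cos (p$2)"
    using cos_eq[of d] cos_eq[of "-d"] d by (simp_all add: cos_add cos_diff)
  \<comment> \<open>Difference and sum of the equations for the two opposite displacements.\<close>
  then have *: "sin (p$2) * sin d = 0" "cos (p$2) * (cos d - 1) = 0"
    by (simp_all add: algebra_simps)
  have "sin d > 0"
    using d pi_gt3 by (intro sin_gt_zero) auto
  then have "sin (p$2) = 0" and "cos d \<noteq> 1"
    using * cos_one_sin_zero[of d] by auto
  then show False
    using * sin_zero_abs_cos_one[of "p$2"] by auto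
qed

text \<open>The principal curvatures are now 1/r, 1/r, 0, so H_1 = 2/(3r), H_2 = 1/(3r^2) is
  constant, H_3 = 0, and 9 H_1 H_2 = 2/r^3.\<close>

lemma L1_gauss_k1_zero:
  assumes k1: "\<forall>s\<in>I. k1 s = 0" and p: "p \<in> U"
  shows "L1_gauss X N p = (2 / r ^ 3) *\<^sub>R N p"
proof -
  have b: "bend q = 0" if "q \<in> U" for q
    using that k1 fst_in_I by (simp add: bend_def)
  have "(mean_curvature X N 2 has_derivative (\<lambda>_. 0)) (at p)"
    by (rule has_derivative_transform_within_open[OF has_derivative_const open_U p])
      (simp add: mean_curvature_tube b)
  then have 0: "frechet_derivative (mean_curvature X N 2) (at p) = (\<lambda>_. 0)"
    by (rule frechet_derivative_at[symmetric])
  obtain u where u: "hypersurface_gradient X (mean_curvature X N 2) p = frechet_derivative X (at p) u"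
    using gradient_H2(1)[OF p p _ p] by auto
  \<comment> \<open>The gradient is tangent and orthogonal to every tangent vector, so nondegeneracy
    kills it.\<close>
  then have "u = 0"
    using gradient_H2(2)[OF p p _ p] 0 by (intro induced_metric_nondegenerate[OF p]) simp
  then have "hypersurface_gradient X (mean_curvature X N 2) p = 0"
    using u linear_0[OF linear_dX[OF p]] by simp
  then show ?thesis
    unfolding L1_gauss_tube[OF p] mean_curvature_tube[OF p p] b[OF p]
    by (simp add: power3_eq_cube)
qed

end

theorem theorem3:
  fixes I :: "real set" and U :: "(real^3) set" and r :: real
    and \<beta> :: "real \<Rightarrow> real^4" and F :: "4 \<Rightarrow> real \<Rightarrow> real^4"
    and k1 k2 k3 :: "real \<Rightarrow> real"
  assumes "open I" and "is_interval I" and "I \<noteq> {}"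
    and "timelike_frenet_curve I \<beta> F k1 k2 k3"
    and "r > 0"
    and "open U" and "connected U" and "(\<lambda>p. p $ 1) ` U = I"
    and "immersion_on U (tube \<beta> F r)"
  shows "((\<exists>m. first_kind_L1_global_pointwise_1_type U (tube \<beta> F r) (tube_normal F) m)
            \<longleftrightarrow> (\<forall>s\<in>I. k1 s = 0)) \<and>
         (\<forall>m. first_kind_L1_global_pointwise_1_type U (tube \<beta> F r) (tube_normal F) m
            \<longrightarrow> m = 2 / r ^ 3)"
proof -
  interpret timelike_tube I U r \<beta> F k1 k2 k3
    using assms by unfold_locales
  let ?P = "first_kind_L1_global_pointwise_1_type U X N"
  have P: "?P m \<longleftrightarrow> m \<noteq> 0 \<and> (\<forall>p\<in>U. L1_gauss X N p = m *\<^sub>R N p)" for m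
    using nonempty_U[OF assms(3)] by (auto simp: first_kind_L1_global_pointwise_1_type_def
        first_kind_L1_pointwise_1_type_def smooth_on_const)
  have k1_0: "\<forall>s\<in>I. k1 s = 0" if "?P m" for m
    using that L1_eq_normal_imp_k1_zero by (auto simp: P)
  have "?P (2 / r ^ 3)" if "\<forall>s\<in>I. k1 s = 0"
    using L1_gauss_k1_zero[OF that] r_pos by (simp add: P)
  moreover have "m = 2 / r ^ 3" if "?P m" for m
  proof -
    obtain p where p: "p \<in> U" using nonempty_U[OF assms(3)] by blast
    have "m *\<^sub>R N p = (2 / r ^ 3) *\<^sub>R N p"
      using that L1_gauss_k1_zero[OF k1_0[OF that] p] p by (simp add: P)
    \<comment> \<open>Pairing with the unit normal compares the two coefficients.\<close>
    then have "m * lorentz (N p) (N p) = (2 / r ^ 3) * lorentz (N p) (N p)"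
      by (metis lorentz_linear(4))
    then show ?thesis by (simp add: normal_unit[OF p])
  qed
  ultimately show ?thesis
    using k1_0 by blast
qed

end
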